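(* Let $\mathcal{I}\subset\mathbb{R}$ be an interval and $f:\mathcal{I}\to\mathbb{R}$ a continuous strictly increasing function. Let $\{X_n : n\ge1\}$ be i.i.d. $\mathcal{I}$-valued random variables on a probability space $(\Omega,\mathcal{F},\mathbb{P})$, let $X$ be a random variable with their common distribution, and suppose $E[f(X)^2]<\infty$. For $N\ge1$ put $$\hat m_N(X)=f^{-1}\Big(\frac1N\big(f(X_1)+\dots+f(X_N)\big)\Big).$$ Then $\hat m_N(X)\to E_f[X]$ as $N\to\infty$, except on a $\mathbb{P}$-null set.
   Context: $E$ denotes expectation with respect to $\mathbb{P}$. The generalized $f$-mean of $X$ is $E_f[X]=f^{-1}\big(E[f(X)]\big)$, where $f^{-1}$ is defined on $f(\mathcal{I})$. *)

theory Defs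
  imports "HOL-Probability.Probability"
begin

(* A function f : I -> R is represented by a total function of which only the values on I
   matter.  Its inverse, a function on f ` I, is inv_into I f; outside f ` I this is an
   unspecified value.  The lemmas below show that both definitions apply it only to points
   of f ` I (for N >= 1). *)

definition f_mean :: "real set \<Rightarrow> (real \<Rightarrow> real) \<Rightarrow> 'a measure \<Rightarrow> ('a \<Rightarrow> real) \<Rightarrow> real" where
  "f_mean I f M X = inv_into I f (LINT \<omega>|M. f (X \<omega>))"

definition sample_f_mean ::
    "real set \<Rightarrow> (real \<Rightarrow> real) \<Rightarrow> (nat \<Rightarrow> 'a \<Rightarrow> real) \<Rightarrow> nat \<Rightarrow> 'a \<Rightarrow> real" where
  "sample_f_mean I f X N \<omega> = inv_into I f ((1 / real N) * (\<Sum>n = 1..N. f (X n \<omega>)))"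

lemma f_mean_in_range:
  fixes f :: "real \<Rightarrow> real" and X :: "'a \<Rightarrow> real"
  assumes "prob_space M" and I: "is_interval I" and f: "continuous_on I f"
    and X: "\<And>\<omega>. \<omega> \<in> space M \<Longrightarrow> X \<omega> \<in> I"
    and int: "integrable M (\<lambda>\<omega>. f (X \<omega>))"
  shows "(LINT \<omega>|M. f (X \<omega>)) \<in> f ` I"
proof (rule ccontr)
  interpret prob_space M by fact
  let ?e = "LINT \<omega>|M. f (X \<omega>)"
  assume e: "?e \<notin> f ` I"
  have J: "is_interval (f ` I)"
    using I f by (simp add: is_interval_connected_1 connected_continuous_image)
  have "(\<forall>y\<in>f ` I. y < ?e) \<or> (\<forall>y\<in>f ` I. ?e < y)"
    using J e unfolding is_interval_1 by (meson linorder_not_le order_less_imp_le)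
  then consider "\<And>\<omega>. \<omega> \<in> space M \<Longrightarrow> f (X \<omega>) < ?e" | "\<And>\<omega>. \<omega> \<in> space M \<Longrightarrow> ?e < f (X \<omega>)"
    using X by blast
  then show False
  proof cases
    case 1
    have "?e < (LINT \<omega>|M. ?e)"
      by (rule integral_less_AE_space) (use 1 int emeasure_space_1 in auto)
    then show False by (simp add: prob_space)
  next
    case 2
    have "(LINT \<omega>|M. ?e) < ?e"
      by (rule integral_less_AE_space) (use 2 int emeasure_space_1 in auto)
    then show False by (simp add: prob_space)
  qed
qed

lemma sample_f_mean_in_range:
  fixes f :: "real \<Rightarrow> real" and X :: "nat \<Rightarrow> 'a \<Rightarrow> real"
  assumes I: "is_interval I" and f: "continuous_on I f"
    and X: "\<And>n. n \<ge> 1 \<Longrightarrow> X n \<omega> \<in> I" and N: "N \<ge> 1"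
  shows "(1 / real N) * (\<Sum>n = 1..N. f (X n \<omega>)) \<in> f ` I"
proof -
  have "convex (f ` I)"
    using I f by (metis connected_continuous_image is_interval_connected_1 is_interval_convex_1)
  then have "(\<Sum>n = 1..N. (1 / real N) *\<^sub>R f (X n \<omega>)) \<in> f ` I"
    by (rule convex_sum[rotated]) (use X N in auto)
  then show ?thesis by (simp add: sum_distrib_left)
qed

end

theory Submission
  imports Defs "HOL-Library.Discrete_Functions"
begin

text \<open>
  The points \<open>f (Xs n \<omega>)\<close> are observations of i.i.d. square integrable variables, so by the
  strong law of large numbers their averages converge almost surely to \<open>E[f(X)]\<close>. The averages
  and the limit all lie in \<open>f ` I\<close>, and the inverse of a strictly increasing function on an
  interval is continuous on the image (\<open>continuous_on_inv_into_strict_mono\<close>); applying it to the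
  averages preserves the convergence.

  The strong law itself comes from an \<open>L\<^sup>2\<close> argument (\<open>AE_orthogonal_averages_tendsto_zero\<close>). Let
  \<open>S n\<close> be the partial sums of pairwise orthogonal variables with second moments at most \<open>C\<close>;
  then \<open>S n - S m\<close> has second moment at most \<open>C (n - m)\<close>. This is too weak to sum
  \<open>E[(S n / n)\<^sup>2]\<close> over all \<open>n\<close>, but it suffices along the squares \<open>n = k\<^sup>2\<close>, where the terms are
  of order \<open>1 / k\<^sup>2\<close>. Between consecutive squares there are only \<open>2 k + 1\<close> indices, and even the sum
  of all squared increments \<open>(S n - S (k\<^sup>2))\<^sup>2\<close> over such a block has expectation of order \<open>k\<^sup>2\<close>.
  Divided by \<open>k\<^sup>4\<close>, the two contributions are summable, hence tend to zero almost everywhere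
  (\<open>AE_tendsto_zero_of_summable_integrals\<close>), and twice their sum bounds \<open>(S n / n)\<^sup>2\<close>.
\<close>

section \<open>Almost everywhere convergence from summable integrals\<close>

text \<open>
  By monotone convergence the series \<open>\<Sum>k. U k x\<close> has a finite integral. It is therefore finite for
  almost every \<open>x\<close>, and the terms of a convergent series tend to zero. This replaces the usual
  combination of Chebyshev's inequality and the Borel-Cantelli lemma.
\<close>

lemma AE_tendsto_zero_of_summable_integrals:
  fixes U :: "nat \<Rightarrow> 'a \<Rightarrow> real"
  assumes int: "\<And>k. integrable M (U k)"
    and nonneg: "\<And>k x. 0 \<le> U k x"
    and sum: "summable (\<lambda>k. LINT x|M. U k x)"
  shows "AE x in M. (\<lambda>k. U k x) \<longlonglongrightarrow> 0"
proof -
  have [measurable]: "U k \<in> borel_measurable M" for k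
    using int by (rule borel_measurable_integrable)
  have "(\<integral>\<^sup>+x. (\<Sum>k. ennreal (U k x)) \<partial>M) = (\<Sum>k. \<integral>\<^sup>+x. ennreal (U k x) \<partial>M)"
    by (rule nn_integral_suminf) measurable
  also have "\<dots> = (\<Sum>k. ennreal (LINT x|M. U k x))"
    using int nonneg by (simp add: nn_integral_eq_integral)
  also have "\<dots> \<noteq> \<infinity>"
    using sum nonneg by (simp add: ennreal_suminf_neq_top)
  finally have "AE x in M. (\<Sum>k. ennreal (U k x)) \<noteq> \<infinity>"
    by (intro nn_integral_PInf_AE) auto
  then show ?thesis
  proof eventually_elim
    case (elim x)
    then have "summable (\<lambda>k. U k x)"
      using nonneg by (intro summable_suminf_not_top) auto
    then show ?case by (rule summable_LIMSEQ_zero)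
  qed
qed

section \<open>The strong law of large numbers for orthogonal variables\<close>

text \<open>Pythagoras: the cross terms of the expanded square integrate to zero.\<close>

lemma
  fixes Z :: "'i \<Rightarrow> 'a \<Rightarrow> real"
  assumes int: "\<And>i j. integrable M (\<lambda>x. Z i x * Z j x)"
    and orth: "\<And>i j. i \<noteq> j \<Longrightarrow> (LINT x|M. Z i x * Z j x) = 0"
    and bound: "\<And>i. (LINT x|M. (Z i x)\<^sup>2) \<le> C"
    and A: "finite A"
  shows integrable_orthogonal_sum_square: "integrable M (\<lambda>x. (\<Sum>i\<in>A. Z i x)\<^sup>2)"
    and integral_orthogonal_sum_square_le:
      "(LINT x|M. (\<Sum>i\<in>A. Z i x)\<^sup>2) \<le> real (card A) * C"
proof -
  have sq: "(\<Sum>i\<in>A. Z i x)\<^sup>2 = (\<Sum>i\<in>A. \<Sum>j\<in>A. Z i x * Z j x)" for x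
    by (simp add: power2_eq_square sum_product)
  show "integrable M (\<lambda>x. (\<Sum>i\<in>A. Z i x)\<^sup>2)"
    unfolding sq using int by simp
  have "(LINT x|M. (\<Sum>i\<in>A. Z i x)\<^sup>2) = (\<Sum>i\<in>A. \<Sum>j\<in>A. LINT x|M. Z i x * Z j x)"
    unfolding sq using int by simp
  also have "\<dots> = (\<Sum>i\<in>A. LINT x|M. (Z i x)\<^sup>2)"
  proof (rule sum.cong[OF refl])
    fix i assume "i \<in> A"
    have "(\<Sum>j\<in>A. LINT x|M. Z i x * Z j x)
        = (\<Sum>j\<in>A. if j = i then LINT x|M. (Z i x)\<^sup>2 else 0)"
      by (rule sum.cong[OF refl]) (use orth in \<open>auto simp: power2_eq_square\<close>)
    then show "(\<Sum>j\<in>A. LINT x|M. Z i x * Z j x) = (LINT x|M. (Z i x)\<^sup>2)"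
      using \<open>i \<in> A\<close> A by simp
  qed
  also have "\<dots> \<le> real (card A) * C"
    using bound sum_bounded_above[of A "\<lambda>i. LINT x|M. (Z i x)\<^sup>2" C] by simp
  finally show "(LINT x|M. (\<Sum>i\<in>A. Z i x)\<^sup>2) \<le> real (card A) * C" .
qed

text \<open>
  The blocks \<open>B k\<close> partition the indices at the squares, and \<open>U k\<close> controls \<open>(S n / n)\<^sup>2\<close> for every
  \<open>n\<close> in \<open>B k\<close>: the partial sum splits at \<open>k\<^sup>2\<close>, and the increment after \<open>k\<^sup>2\<close> is one of the
  nonnegative terms of the sum over the block.
\<close>

lemma AE_orthogonal_averages_tendsto_zero:
  fixes Z :: "nat \<Rightarrow> 'a \<Rightarrow> real"
  assumes int: "\<And>i j. integrable M (\<lambda>x. Z i x * Z j x)"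
    and orth: "\<And>i j. i \<noteq> j \<Longrightarrow> (LINT x|M. Z i x * Z j x) = 0"
    and bound: "\<And>i. (LINT x|M. (Z i x)\<^sup>2) \<le> C"
  shows "AE x in M. (\<lambda>n. (\<Sum>i<n. Z i x) / real n) \<longlonglongrightarrow> 0"
proof -
  define B where "B k = {k\<^sup>2..k\<^sup>2 + 2 * k}" for k :: nat
  define U where "U k x = ((\<Sum>i<k\<^sup>2. Z i x)\<^sup>2 + (\<Sum>n\<in>B k. (\<Sum>i\<in>{k\<^sup>2..<n}. Z i x)\<^sup>2)) / real k ^ 4"
    for k x
  note int_sq = integrable_orthogonal_sum_square[where Z = Z, OF int orth bound]
  note le_sq = integral_orthogonal_sum_square_le[where Z = Z, OF int orth bound]
  have C: "0 \<le> C"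
    using bound[of 0] by (rule order_trans[rotated]) simp
  have U_int: "integrable M (U k)" for k
    unfolding U_def using int_sq by simp
  have U_nonneg: "0 \<le> U k x" for k x
    unfolding U_def by (intro divide_nonneg_nonneg add_nonneg_nonneg sum_nonneg) auto
  have U_le: "(LINT x|M. U k x) \<le> 10 * C * inverse (real k ^ 2)" for k
  proof (cases "k = 0")
    case True
    then show ?thesis by (simp add: U_def)
  next
    case False
    then have k: "1 \<le> real k" by simp
    have "(LINT x|M. U k x) = ((LINT x|M. (\<Sum>i<k\<^sup>2. Z i x)\<^sup>2)
        + (\<Sum>n\<in>B k. LINT x|M. (\<Sum>i\<in>{k\<^sup>2..<n}. Z i x)\<^sup>2)) / real k ^ 4"
      unfolding U_def using int_sq by simp
    also have "\<dots> \<le> ((real k)\<^sup>2 * C + (\<Sum>n\<in>B k. (2 * real k + 1) * C)) / real k ^ 4"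
    proof (intro divide_right_mono add_mono sum_mono)
      show "(LINT x|M. (\<Sum>i<k\<^sup>2. Z i x)\<^sup>2) \<le> (real k)\<^sup>2 * C"
        using le_sq[of "{..<k\<^sup>2}"] by simp
      fix n assume "n \<in> B k"
      then have "card {k\<^sup>2..<n} \<le> 2 * k + 1"
        by (auto simp: B_def)
      then have "real (card {k\<^sup>2..<n}) \<le> 2 * real k + 1"
        by linarith
      then show "(LINT x|M. (\<Sum>i\<in>{k\<^sup>2..<n}. Z i x)\<^sup>2) \<le> (2 * real k + 1) * C"
        using le_sq[of "{k\<^sup>2..<n}"] mult_right_mono[OF _ C] by fastforce
    qed simp
    also have "\<dots> = ((real k)\<^sup>2 + (2 * real k + 1)\<^sup>2) * C / real k ^ 4"
      by (simp add: B_def power2_eq_square algebra_simps)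
    also have "\<dots> \<le> (10 * (real k)\<^sup>2) * C / real k ^ 4"
    proof (intro divide_right_mono mult_right_mono C)
      have "(2 * real k + 1)\<^sup>2 \<le> (3 * real k)\<^sup>2"
        using k by (intro power_mono) auto
      then show "(real k)\<^sup>2 + (2 * real k + 1)\<^sup>2 \<le> 10 * (real k)\<^sup>2"
        by (simp add: power_mult_distrib)
    qed simp
    also have "\<dots> = 10 * C * inverse (real k ^ 2)"
      using k by (simp add: field_simps eval_nat_numeral)
    finally show ?thesis .
  qed
  have "summable (\<lambda>k. LINT x|M. U k x)"
  proof (rule summable_comparison_test')
    show "summable (\<lambda>k. 10 * C * inverse (real k ^ 2))"
      by (intro summable_mult inverse_power_summable) simp
    show "norm (LINT x|M. U k x) \<le> 10 * C * inverse (real k ^ 2)" if "0 \<le> k" for k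
      using U_le U_nonneg by (simp add: integral_nonneg)
  qed
  then have "AE x in M. (\<lambda>k. U k x) \<longlonglongrightarrow> 0"
    by (intro AE_tendsto_zero_of_summable_integrals U_int U_nonneg)
  then show ?thesis
  proof eventually_elim
    case (elim x)
    \<comment> \<open>The block that contains \<open>n\<close> is the one with index \<open>floor_sqrt n\<close>.\<close>
    have "filterlim floor_sqrt at_top sequentially"
      unfolding filterlim_at_top eventually_sequentially by (meson le_floor_sqrt_iff)
    with elim have "(\<lambda>n. U (floor_sqrt n) x) \<longlonglongrightarrow> 0"
      by (rule filterlim_compose)
    then have U_lim: "(\<lambda>n. 2 * U (floor_sqrt n) x) \<longlonglongrightarrow> 0"
      by (rule tendsto_mult_right_zero)
    have le: "((\<Sum>i<n. Z i x) / real n)\<^sup>2 \<le> 2 * U (floor_sqrt n) x" if n: "n > 0" for n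
    proof -
      define k where "k = floor_sqrt n"
      have k: "k > 0" "k\<^sup>2 \<le> n" using n by (simp_all add: k_def)
      have "n < (Suc k)\<^sup>2" unfolding k_def by (rule Suc_floor_sqrt_power2_gt)
      with k have nB: "n \<in> B k" by (auto simp: B_def power2_eq_square)
      define a where "a = (\<Sum>i<k\<^sup>2. Z i x)"
      define b where "b = (\<Sum>i\<in>{k\<^sup>2..<n}. Z i x)"
      have "(\<Sum>i<n. Z i x) = a + b"
        unfolding a_def b_def using k sum.atLeastLessThan_concat[of 0 "k\<^sup>2" n "\<lambda>i. Z i x"]
        by (simp add: lessThan_atLeast0)
      moreover have "(a + b)\<^sup>2 \<le> 2 * (a\<^sup>2 + b\<^sup>2)"
        using zero_le_power2[of "a - b"] by (simp add: power2_diff power2_sum)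
      moreover have "b\<^sup>2 \<le> (\<Sum>n\<in>B k. (\<Sum>i\<in>{k\<^sup>2..<n}. Z i x)\<^sup>2)"
        unfolding b_def using nB by (intro member_le_sum) (auto simp: B_def)
      ultimately have num: "(\<Sum>i<n. Z i x)\<^sup>2 \<le> 2 * U k x * real k ^ 4"
        using k by (simp add: U_def a_def)
      have "real k ^ 4 = (real (k\<^sup>2))\<^sup>2" by simp
      also have "\<dots> \<le> (real n)\<^sup>2"
        using k by (intro power_mono of_nat_mono) auto
      finally have "2 * U k x * real k ^ 4 \<le> 2 * U k x * (real n)\<^sup>2"
        using U_nonneg by (intro mult_left_mono) auto
      with num have "(\<Sum>i<n. Z i x)\<^sup>2 \<le> 2 * U k x * (real n)\<^sup>2" by simp
      then show ?thesis
        using n by (simp add: power_divide divide_le_eq k_def)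
    qed
    have "(\<lambda>n. ((\<Sum>i<n. Z i x) / real n)\<^sup>2) \<longlonglongrightarrow> 0"
    proof (rule tendsto_sandwich[OF _ _ tendsto_const U_lim])
      show "eventually (\<lambda>n. ((\<Sum>i<n. Z i x) / real n)\<^sup>2 \<le> 2 * U (floor_sqrt n) x) sequentially"
        using eventually_gt_at_top[of 0] by eventually_elim (rule le)
    qed simp
    then show ?case
      using tendsto_real_sqrt tendsto_rabs_zero_cancel by fastforce
  qed
qed

text \<open>
  Centring turns pairwise independence into orthogonality, because the expectation of a product of
  independent variables factorizes; the variances become the second moments.
\<close>

theorem (in prob_space) AE_averages_tendsto_expectation:
  fixes Y :: "nat \<Rightarrow> 'a \<Rightarrow> real"
  assumes indep: "\<And>i j. i \<noteq> j \<Longrightarrow> indep_var borel (Y i) borel (Y j)"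
    and sq: "\<And>i. integrable M (\<lambda>x. (Y i x)\<^sup>2)"
    and mean: "\<And>i. expectation (Y i) = m"
    and bound: "\<And>i. variance (Y i) \<le> C"
  shows "AE x in M. (\<lambda>n. (\<Sum>i<n. Y i x) / real n) \<longlonglongrightarrow> m"
proof -
  define Z where "Z i x = Y i x - m" for i x
  have [measurable]: "Y i \<in> borel_measurable M" for i
    using indep[of i "Suc i"] by (simp add: indep_var_rv1)
  have Y_int: "integrable M (Y i)" for i
    by (rule square_integrable_imp_integrable) (use sq in auto)
  have Z_int: "integrable M (Z i)" for i
    unfolding Z_def using Y_int by simp
  have Z_mean: "expectation (Z i) = 0" for i
    unfolding Z_def using Y_int mean by (simp add: prob_space)
  have Z_sq: "integrable M (\<lambda>x. (Z i x)\<^sup>2)" for i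
    unfolding Z_def power2_diff using sq Y_int by simp
  have prod: "integrable M (\<lambda>x. Z i x * Z j x)" "expectation (\<lambda>x. Z i x * Z j x) = 0"
    if "i \<noteq> j" for i j
  proof -
    have ij: "indep_var borel (Z i) borel (Z j)"
      using indep_var_compose[OF indep[OF that], of "\<lambda>y. y - m" borel "\<lambda>y. y - m" borel]
      by (simp add: Z_def[abs_def] comp_def)
    show "integrable M (\<lambda>x. Z i x * Z j x)"
      using ij Z_int Z_int by (rule indep_var_integrable)
    show "expectation (\<lambda>x. Z i x * Z j x) = 0"
      using indep_var_lebesgue_integral[OF ij] Z_int Z_mean by simp
  qed
  have "AE x in M. (\<lambda>n. (\<Sum>i<n. Z i x) / real n) \<longlonglongrightarrow> 0"
  proof (rule AE_orthogonal_averages_tendsto_zero)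
    show "integrable M (\<lambda>x. Z i x * Z j x)" for i j
      using prod(1)[of i j] Z_sq[of i] by (cases "i = j") (auto simp: power2_eq_square)
    show "expectation (\<lambda>x. (Z i x)\<^sup>2) \<le> C" for i
      using bound[of i] by (simp add: Z_def mean)
  qed (rule prod)
  then show ?thesis
  proof eventually_elim
    case (elim x)
    have "(\<lambda>n. (\<Sum>i<n. Z i x) / real n + m) \<longlonglongrightarrow> 0 + m"
      by (intro tendsto_add elim tendsto_const)
    moreover have "eventually (\<lambda>n. (\<Sum>i<n. Z i x) / real n + m = (\<Sum>i<n. Y i x) / real n) sequentially"
      by (auto simp: eventually_sequentially Z_def sum_subtractf field_simps intro!: exI[of _ 1])
    ultimately show ?case
      using filterlim_cong by fastforce
  qed
qed

section \<open>Convergence of the sample mean\<close>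

text \<open>
  Suppose \<open>a < x\<close>, where \<open>x\<close> is the preimage of \<open>y\<close>. If \<open>a\<close> lies in \<open>I\<close>, then \<open>f a < y\<close>, so
  nearby values \<open>z\<close> exceed \<open>f a\<close> and have preimages above \<open>a\<close>. Otherwise, as \<open>I\<close> has no gaps, all
  of \<open>I\<close> lies above \<open>a\<close>. Upper bounds are symmetric. A jump of \<open>f\<close> does no
  harm, since it only makes a gap in the domain of the inverse.
\<close>

lemma continuous_on_inv_into_strict_mono:
  fixes f :: "'a::linorder_topology \<Rightarrow> 'b::linorder_topology"
  assumes I: "\<And>a b c. a \<in> I \<Longrightarrow> b \<in> I \<Longrightarrow> a \<le> c \<Longrightarrow> c \<le> b \<Longrightarrow> c \<in> I"
    and f: "strict_mono_on I f"
  shows "continuous_on (f ` I) (inv_into I f)"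
  unfolding continuous_on_def
proof (intro ballI order_tendstoI)
  have inv: "inv_into I f (f x) = x" if "x \<in> I" for x
    using f that by (simp add: strict_mono_on_imp_inj_on)
  fix y a assume y: "y \<in> f ` I"
  then obtain x where x: "x \<in> I" "y = f x" by blast
  {
    assume "a < inv_into I f y"
    then have ax: "a < x" using x inv by simp
    show "eventually (\<lambda>z. a < inv_into I f z) (at y within f ` I)"
    proof (cases "\<exists>b\<in>I. b \<le> a")
      case True
      then have "a \<in> I" using I x ax by (meson less_imp_le)
      then have "f a < y" using f ax x by (simp add: strict_mono_onD)
      then have "eventually (\<lambda>z. f a < z) (at y within f ` I)"
        by (rule order_tendstoD(1)[OF tendsto_ident_at])
      moreover have "eventually (\<lambda>z. z \<in> f ` I) (at y within f ` I)"
        by (simp add: eventually_at_filter)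
      ultimately show ?thesis
      proof eventually_elim
        case (elim z)
        then show ?case using inv \<open>a \<in> I\<close> f by (auto simp: strict_mono_on_less)
      qed
    next
      case False
      then show ?thesis
        by (auto simp: eventually_at_filter inv not_le intro!: always_eventually)
    qed
  next
    assume "inv_into I f y < a"
    then have ax: "x < a" using x inv by simp
    show "eventually (\<lambda>z. inv_into I f z < a) (at y within f ` I)"
    proof (cases "\<exists>b\<in>I. a \<le> b")
      case True
      then have "a \<in> I" using I x ax by (meson less_imp_le)
      then have "y < f a" using f ax x by (simp add: strict_mono_onD)
      then have "eventually (\<lambda>z. z < f a) (at y within f ` I)"
        by (rule order_tendstoD(2)[OF tendsto_ident_at])
      moreover have "eventually (\<lambda>z. z \<in> f ` I) (at y within f ` I)"
        by (simp add: eventually_at_filter)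
      ultimately show ?thesis
      proof eventually_elim
        case (elim z)
        then show ?case using inv \<open>a \<in> I\<close> f by (auto simp: strict_mono_on_less)
      qed
    next
      case False
      then show ?thesis
        by (auto simp: eventually_at_filter inv not_le intro!: always_eventually)
    qed
  }
qed

theorem theorem6p2:
  fixes M :: "'a measure" and I :: "real set" and f :: "real \<Rightarrow> real"
    and Xs :: "nat \<Rightarrow> 'a \<Rightarrow> real" and X :: "'a \<Rightarrow> real"
  assumes "prob_space M"
    and "is_interval I"
    and "continuous_on I f"
    and "strict_mono_on I f"
    and "prob_space.indep_vars M (\<lambda>_. borel) Xs {1..}"
    and "\<And>n \<omega>. n \<ge> 1 \<Longrightarrow> \<omega> \<in> space M \<Longrightarrow> Xs n \<omega> \<in> I"
    and "X \<in> borel_measurable M"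
    and "\<And>\<omega>. \<omega> \<in> space M \<Longrightarrow> X \<omega> \<in> I"
    and "\<And>n. n \<ge> 1 \<Longrightarrow> distr M borel (Xs n) = distr M borel X"
    and "integrable M (\<lambda>\<omega>. (f (X \<omega>))\<^sup>2)"
  shows "AE \<omega> in M. (\<lambda>N. sample_f_mean I f Xs N \<omega>) \<longlonglongrightarrow> f_mean I f M X"
proof -
  interpret prob_space M by fact
  note I = \<open>is_interval I\<close> and f_cont = \<open>continuous_on I f\<close> and f_mono = \<open>strict_mono_on I f\<close>
  note Xs_I = assms(6) and X_I = assms(8) and same_distr = assms(9)
  have [measurable]: "X \<in> borel_measurable M" by fact
  have [measurable]: "Xs n \<in> borel_measurable M" if "n \<ge> 1" for n
    using assms(5) that by (simp add: indep_vars_def)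
  \<comment> \<open>The values of \<open>f\<close> outside \<open>I\<close> are arbitrary; replacing them by a constant makes the function
      Borel measurable without changing it at any value of the random variables.\<close>
  define g where "g y = (if y \<in> I then f y else 0)" for y
  have "I \<in> sets borel"
    using I by (simp add: is_interval_convex_1 real_interval_borel_measurable)
  then have [measurable]: "g \<in> borel_measurable borel"
    unfolding g_def using f_cont by (intro borel_measurable_continuous_on_if) auto
  have gX: "g (X x) = f (X x)" if "x \<in> space M" for x
    using X_I[OF that] by (simp add: g_def)
  \<comment> \<open>The observations are numbered from 1, the strong law numbers its variables from 0.\<close>
  define Y where "Y i x = g (Xs (Suc i) x)" for i x
  have transfer: "integrable M (\<lambda>x. h (Y i x)) \<longleftrightarrow> integrable M (\<lambda>x. h (g (X x)))"
      "expectation (\<lambda>x. h (Y i x)) = expectation (\<lambda>x. h (g (X x)))"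
    if [measurable]: "h \<in> borel_measurable borel" for h :: "real \<Rightarrow> real" and i
  proof -
    have [measurable]: "Xs (Suc i) \<in> borel_measurable M" by simp
    show "integrable M (\<lambda>x. h (Y i x)) \<longleftrightarrow> integrable M (\<lambda>x. h (g (X x)))"
      unfolding Y_def
      using integrable_distr_eq[of "Xs (Suc i)" M borel "\<lambda>y. h (g y)"]
        integrable_distr_eq[of X M borel "\<lambda>y. h (g y)"] same_distr[of "Suc i"] by simp
    show "expectation (\<lambda>x. h (Y i x)) = expectation (\<lambda>x. h (g (X x)))"
      unfolding Y_def
      using integral_distr[of "Xs (Suc i)" M borel "\<lambda>y. h (g y)"]
        integral_distr[of X M borel "\<lambda>y. h (g y)"] same_distr[of "Suc i"] by simp
  qed
  define m where "m = expectation (\<lambda>x. f (X x))"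
  have gX_sq: "integrable M (\<lambda>x. (g (X x))\<^sup>2)"
    using assms(10) gX by (simp cong: Bochner_Integration.integrable_cong)
  have Y_mean: "expectation (Y i) = m" for i
    using transfer(2)[of "\<lambda>y. y" i] gX by (simp add: m_def cong: Bochner_Integration.integral_cong)
  have f_int: "integrable M (\<lambda>x. f (X x))"
    using square_integrable_imp_integrable[OF _ gX_sq] gX
    by (simp cong: Bochner_Integration.integrable_cong)
  have "AE x in M. (\<lambda>n. (\<Sum>i<n. Y i x) / real n) \<longlonglongrightarrow> m"
  proof (rule AE_averages_tendsto_expectation)
    show "indep_var borel (Y i) borel (Y j)" if "i \<noteq> j" for i j
    proof -
      have "indep_vars (\<lambda>_. borel) Xs (insert (Suc i) {Suc j})"
        using assms(5) by (rule indep_vars_subset) simp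
      \<comment> \<open>Independence of \<open>Xs (Suc i)\<close> from a sum of other variables, for a sum with one term.\<close>
      then have "indep_var borel (Xs (Suc i)) borel (Xs (Suc j))"
        using indep_vars_sum[of "{Suc j}" "Suc i" Xs] that by simp
      then show ?thesis
        using indep_var_compose[of borel _ borel _ g borel g borel]
        by (simp add: Y_def[abs_def] comp_def)
    qed
    show "integrable M (\<lambda>x. (Y i x)\<^sup>2)" for i
      using transfer(1)[of "\<lambda>y. y\<^sup>2" i] gX_sq by simp
    show "variance (Y i) \<le> variance (\<lambda>x. g (X x))" for i
      using transfer(2)[of "\<lambda>y. (y - m)\<^sup>2" i] transfer(2)[of "\<lambda>y. y" i] Y_mean[of i] by simp
  qed (rule Y_mean)
  then show ?thesis
    using AE_space
  proof eventually_elim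
    case (elim x)
    have avg: "(1 / real N) * (\<Sum>n = 1..N. f (Xs n x)) = (\<Sum>i<N. Y i x) / real N" for N
      using Xs_I[OF _ \<open>x \<in> space M\<close>] by (simp add: Y_def g_def sum.atLeast1_atMost_eq)
    have "m \<in> f ` I"
      unfolding m_def using \<open>prob_space M\<close> I f_cont X_I f_int by (rule f_mean_in_range)
    moreover have "eventually (\<lambda>N. (\<Sum>i<N. Y i x) / real N \<in> f ` I) sequentially"
      using sample_f_mean_in_range[OF I f_cont, of Xs x] Xs_I \<open>x \<in> space M\<close> unfolding avg
      by (auto simp: eventually_sequentially)
    moreover have "continuous_on (f ` I) (inv_into I f)"
      using I f_mono unfolding is_interval_1 by (intro continuous_on_inv_into_strict_mono) blast+
    ultimately have "(\<lambda>N. inv_into I f ((\<Sum>i<N. Y i x) / real N)) \<longlonglongrightarrow> inv_into I f m"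
      using elim(1) continuous_on_tendsto_compose by blast
    then show ?case
      unfolding sample_f_mean_def f_mean_def avg m_def .
  qed
qed

end
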